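(* Let $\mathcal{L}=\{L_1,\dots,L_s\}$ be a line arrangement in the complex projective plane $\mathbb{P}^2_{\mathbb{C}}$ which is nontrivial, i.e., neither a pencil nor a near pencil. Assume that every crossing point of $\mathcal{L}$ has multiplicity equal to $3$ or $4$. Then $\mathcal{L}$ is not supersolvable.
   Context: A line arrangement is a finite set $\mathcal{L}=\{L_1,\dots,L_s\}$ of $s>1$ distinct lines in the projective plane over a field. A crossing point of $\mathcal{L}$ is a point where two or more lines of $\mathcal{L}$ meet; its multiplicity is the number of lines of $\mathcal{L}$ containing it. A modular point of $\mathcal{L}$ is a crossing point $p$ such that for every other crossing point $q\neq p$ of $\mathcal{L}$, the line through $p$ and $q$ belongs to $\mathcal{L}$. $\mathcal{L}$ is supersolvable if it has at least one modular point. $\mathcal{L}$ is a pencil if all $s$ of its lines pass through a common point, and a near pencil if exactly $s-1$ of its $s$ lines ($s\geq 3$) are concurrent. *)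

theory Defs
  imports "HOL-Analysis.Analysis"
begin

text \<open>
  The projective plane over a field is modelled by the nonzero proper linear subspaces of
  the three-dimensional coordinate space: points are the one-dimensional subspaces, lines the
  two-dimensional ones, and incidence is inclusion.  The prefixed notions \<open>vec.subspace\<close>,
  \<open>vec.dim\<close>, \<open>vec.span\<close> are those over the coefficient field; the unprefixed ones would be
  real-linear, also on complex vectors.
\<close>

definition proj_points :: "('a::field ^ 3) set set" where
  "proj_points = {p. vec.subspace p \<and> vec.dim p = 1}"

definition proj_lines :: "('a::field ^ 3) set set" where
  "proj_lines = {l. vec.subspace l \<and> vec.dim l = 2}"

definition line_through :: "('a::field ^ 3) set \<Rightarrow> ('a ^ 3) set \<Rightarrow> ('a ^ 3) set" where
  "line_through p q = vec.span (p \<union> q)"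

lemma line_through_unique:
  fixes p q :: "('a::field ^ 3) set"
  assumes p: "p \<in> proj_points" and q: "q \<in> proj_points" and "p \<noteq> q"
  shows "line_through p q \<in> proj_lines"
    and "l \<in> proj_lines \<Longrightarrow> p \<subseteq> l \<Longrightarrow> q \<subseteq> l \<Longrightarrow> l = line_through p q"
proof -
  have sp: "vec.subspace p" "vec.dim p = 1" and sq: "vec.subspace q" "vec.dim q = 1"
    using p q by (auto simp: proj_points_def)
  have "\<not> p \<subseteq> q"
    using vec.subspace_dim_equal[OF sp(1) sq(1)] sp(2) sq(2) \<open>p \<noteq> q\<close> by auto
  then have "p \<inter> q \<noteq> p" by auto
  then have "vec.dim (p \<inter> q) \<noteq> 1"
    using vec.subspace_dim_equal[OF vec.subspace_inter[OF sp(1) sq(1)] sp(1)] sp(2) by auto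
  moreover have "vec.dim (p \<inter> q) \<le> 1"
    using vec.dim_subset[of "p \<inter> q" p] sp(2) by auto
  ultimately have "vec.dim (p \<inter> q) = 0" by linarith
  then have "vec.dim {x + y |x y. x \<in> p \<and> y \<in> q} = 2"
    using vec.dim_sums_Int[OF sp(1) sq(1)] sp(2) sq(2) by linarith
  moreover have "vec.span (p \<union> q) = {x + y |x y. x \<in> p \<and> y \<in> q}"
    using vec.span_Un[of p q] sp(1) sq(1) by (simp add: vec.span_eq_iff[THEN iffD2])
  ultimately have dim: "vec.dim (line_through p q) = 2"
    by (simp add: line_through_def)
  then show "line_through p q \<in> proj_lines"
    by (simp add: proj_lines_def line_through_def)
  assume l: "l \<in> proj_lines" "p \<subseteq> l" "q \<subseteq> l"
  then have sl: "vec.subspace l" "vec.dim l = 2" by (auto simp: proj_lines_def)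
  have "line_through p q \<subseteq> l"
    unfolding line_through_def using l sl by (intro vec.span_minimal) auto
  then have "line_through p q = l"
    by (intro vec.subspace_dim_equal) (use dim sl in \<open>auto simp: line_through_def\<close>)
  then show "l = line_through p q" by simp
qed

definition line_arrangement :: "('a::field ^ 3) set set \<Rightarrow> bool" where
  "line_arrangement A \<longleftrightarrow> finite A \<and> A \<subseteq> proj_lines \<and> card A > 1"

definition point_multiplicity :: "('a::field ^ 3) set set \<Rightarrow> ('a ^ 3) set \<Rightarrow> nat" where
  "point_multiplicity A p = card {l \<in> A. p \<subseteq> l}"

definition crossing_points :: "('a::field ^ 3) set set \<Rightarrow> ('a ^ 3) set set" where
  "crossing_points A = {p \<in> proj_points. point_multiplicity A p \<ge> 2}"

definition modular_point :: "('a::field ^ 3) set set \<Rightarrow> ('a ^ 3) set \<Rightarrow> bool" where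
  "modular_point A p \<longleftrightarrow>
     p \<in> crossing_points A \<and> (\<forall>q \<in> crossing_points A. q \<noteq> p \<longrightarrow> line_through p q \<in> A)"

definition supersolvable :: "('a::field ^ 3) set set \<Rightarrow> bool" where
  "supersolvable A \<longleftrightarrow> (\<exists>p. modular_point A p)"

definition pencil :: "('a::field ^ 3) set set \<Rightarrow> bool" where
  "pencil A \<longleftrightarrow> (\<exists>p \<in> proj_points. \<forall>l \<in> A. p \<subseteq> l)"

definition near_pencil :: "('a::field ^ 3) set set \<Rightarrow> bool" where
  "near_pencil A \<longleftrightarrow>
     card A \<ge> 3 \<and> (\<exists>p \<in> proj_points. card {l \<in> A. p \<subseteq> l} = card A - 1)"

end

theory Submission
  imports Defs
begin

text \<open>
  Let \<open>p\<close> be a modular point and \<open>L0\<close> a line of the arrangement that avoids it.  Every line \<open>M\<close>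
  of the arrangement through \<open>p\<close> meets \<open>L0\<close> in a crossing point, which lies on a third line
  \<open>L M\<close> since it is not a double point.  For \<open>M \<noteq> M'\<close> the point \<open>L M \<inter> L M'\<close> lies, by modularity,
  on a line \<open>K\<close> through \<open>p\<close> different from \<open>M\<close> and \<open>M'\<close>.  Regarding lines avoiding \<open>p\<close> as graphs
  of linear forms on \<open>L0\<close>, and writing \<open>[M M']\<close> for the determinant of the forms of \<open>L M\<close> and
  \<open>L M'\<close>, this says \<open>[M K] = [M' K]\<close>.  With three or four lines through \<open>p\<close>, such
  equations for all pairs contradict, in characteristic 0, the antisymmetry of the brackets,
  their non-vanishing and the Pluecker relation.
\<close>

section \<open>Points, lines and linear forms in the projective plane\<close>

lemma proj_points_subset_imp_eq:
  assumes "p \<in> proj_points" "q \<in> proj_points" "p \<subseteq> q"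
  shows "p = q"
  using assms vec.subspace_dim_equal[of p q] by (auto simp: proj_points_def)

lemma proj_line_eqI:
  fixes p q :: "('a::field ^ 3) set"
  assumes "p \<in> proj_points" "q \<in> proj_points" "p \<noteq> q"
    and "l \<in> proj_lines" "p \<subseteq> l" "q \<subseteq> l"
    and "l' \<in> proj_lines" "p \<subseteq> l'" "q \<subseteq> l'"
  shows "l = l'"
  using line_through_unique(2)[OF assms(1-6)] line_through_unique(2)[OF assms(1-3,7-9)] by simp

text \<open>By the dimension formula the intersection has dimension at least 2 + 2 - 3 = 1;
  dimension 2 would make both lines equal to it.\<close>

lemma proj_lines_Int:
  fixes l l' :: "('a::field ^ 3) set"
  assumes l: "l \<in> proj_lines" and l': "l' \<in> proj_lines" and "l \<noteq> l'"
  shows "l \<inter> l' \<in> proj_points"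
proof -
  have s: "vec.subspace l" "vec.dim l = 2" and s': "vec.subspace l'" "vec.dim l' = 2"
    using l l' by (auto simp: proj_lines_def)
  have si: "vec.subspace (l \<inter> l')"
    using s s' by (simp add: vec.subspace_inter)
  have "vec.dim {x + y |x y. x \<in> l \<and> y \<in> l'} \<le> 3"
    using dim_subset_UNIV_cart_gen[of "{x + y |x y. x \<in> l \<and> y \<in> l'}"] by simp
  then have "vec.dim (l \<inter> l') \<ge> 1"
    using vec.dim_sums_Int[OF s(1) s'(1)] s(2) s'(2) by linarith
  moreover have "vec.dim (l \<inter> l') < 2"
  proof (rule ccontr)
    assume "\<not> vec.dim (l \<inter> l') < 2"
    then have "l \<inter> l' = l" and "l \<inter> l' = l'"
      using vec.subspace_dim_equal[OF si s(1)] vec.subspace_dim_equal[OF si s'(1)] s(2) s'(2) by auto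
    with \<open>l \<noteq> l'\<close> show False by metis
  qed
  ultimately show ?thesis
    using si by (simp add: proj_points_def)
qed

lemma proj_point_eq_span:
  fixes p :: "('a::field ^ 3) set"
  assumes "p \<in> proj_points"
  obtains u where "u \<noteq> 0" "p = vec.span {u}"
proof -
  have s: "vec.subspace p" "vec.dim p = 1"
    using assms by (auto simp: proj_points_def)
  obtain u where u: "u \<in> p" "u \<noteq> 0"
    using s vec.dim_eq_0[of p] by auto
  have "vec.span {u} = p"
    using u s by (intro vec.subspace_dim_equal vec.span_minimal) (auto simp: vec.dim_insert)
  with u that show thesis by blast
qed

lemma proj_point_subset_iff:
  assumes "vec.subspace l"
  shows "vec.span {u} \<subseteq> l \<longleftrightarrow> u \<in> l"
  using assms vec.span_base[of u "{u}"] vec.span_minimal[of "{u}" l] by auto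

lemma line_through_span:
  fixes u v :: "'a::field ^ 3"
  shows "line_through (vec.span {u}) (vec.span {v}) = vec.span {u, v}"
proof (rule antisym)
  show "line_through (vec.span {u}) (vec.span {v}) \<subseteq> vec.span {u, v}"
    unfolding line_through_def by (intro vec.span_minimal Un_least vec.span_mono) auto
  show "vec.span {u, v} \<subseteq> line_through (vec.span {u}) (vec.span {v})"
    unfolding line_through_def by (intro vec.span_mono) (auto intro: vec.span_base)
qed

lemma span_pairE:
  fixes u v x :: "'a::field ^ 3"
  assumes "x \<in> vec.span {u, v}"
  obtains \<alpha> \<beta> where "x = \<alpha> *s u + \<beta> *s v"
proof -
  obtain \<alpha> where "x - \<alpha> *s u \<in> vec.span {v}"
    using assms by (auto simp: vec.span_breakdown_eq[of x u "{v}"])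
  then obtain \<beta> where "x - \<alpha> *s u = \<beta> *s v"
    by (auto simp: vec.span_singleton)
  then have "x = \<alpha> *s u + \<beta> *s v"
    by (simp add: diff_eq_eq add.commute)
  with that show thesis .
qed

text \<open>\<open>f x\<close> is the coefficient of \<open>u\<close> in the splitting of the space
  into \<open>l\<close> and the span of \<open>u\<close>. Normalizing by \<open>f u = 1\<close>
  makes the forms of different lines comparable.\<close>

lemma proj_line_functional:
  fixes l :: "('a::field ^ 3) set"
  assumes l: "l \<in> proj_lines" and u: "u \<notin> l"
  obtains f :: "'a ^ 3 \<Rightarrow> 'a"
  where "\<And>x y. f (x + y) = f x + f y" "\<And>c x. f (c *s x) = c * f x"
    "f u = 1" "\<And>x. f x = 0 \<longleftrightarrow> x \<in> l"
proof -
  have s: "vec.subspace l" "vec.dim l = 2"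
    using l by (auto simp: proj_lines_def)
  have sl: "vec.span l = l"
    using s by simp
  have "u \<notin> vec.span l"
    using u unfolding sl .
  then have "vec.dim (insert u l) = CARD(3)"
    using s by (simp add: vec.dim_insert)
  then have "vec.span (insert u l) = UNIV"
    by (metis vec.dim_eq_full vec.dim_UNIV vec_dim_card vec.dimension_def)
  then have ex: "\<exists>k. x - k *s u \<in> l" for x
    using vec.span_breakdown_eq[of x u l] sl by auto
  have uniq: "k = k'" if "x - k *s u \<in> l" "x - k' *s u \<in> l" for x k k'
  proof (rule ccontr)
    assume "k \<noteq> k'"
    have "(x - k' *s u) - (x - k *s u) \<in> l"
      using that s(1) vec.subspace_diff by blast
    then have "(k - k') *s u \<in> l"
      by (simp add: vector_sub_rdistrib)
    then have "inverse (k - k') *s ((k - k') *s u) \<in> l"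
      using s(1) vec.subspace_scale by blast
    with \<open>k \<noteq> k'\<close> u show False
      by (simp add: vector_smult_assoc del: vector_sub_rdistrib vec.scale_left_diff_distrib)
  qed
  define f where "f x = (THE k. x - k *s u \<in> l)" for x
  have f: "x - f x *s u \<in> l" for x
    unfolding f_def using ex[of x] uniq by (metis theI)
  have f_eq: "f x = k" if "x - k *s u \<in> l" for x k
    using uniq[OF f that] .
  show thesis
  proof
    fix x y
    have "(x - f x *s u) + (y - f y *s u) \<in> l"
      using f s(1) vec.subspace_add by blast
    then show "f (x + y) = f x + f y"
      by (intro f_eq) (simp add: algebra_simps)
  next
    fix c x
    have "c *s (x - f x *s u) \<in> l"
      using f s(1) vec.subspace_scale by blast
    then show "f (c *s x) = c * f x"
      by (intro f_eq) simp
  next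
    show "f u = 1"
      using s(1) by (intro f_eq) (simp add: vec.subspace_0)
  next
    fix x
    show "f x = 0 \<longleftrightarrow> x \<in> l"
      using f[of x] f_eq[of x 0] by auto
  qed
qed

section \<open>Crossing points and their multiplicities\<close>

lemma crossing_pointI:
  assumes "finite A" "l \<in> A" "l' \<in> A" "l \<noteq> l'" "q \<in> proj_points" "q \<subseteq> l" "q \<subseteq> l'"
  shows "q \<in> crossing_points A"
proof -
  have "card {l, l'} \<le> card {l \<in> A. q \<subseteq> l}"
    using assms by (intro card_mono) auto
  with assms show ?thesis
    by (simp add: crossing_points_def point_multiplicity_def)
qed

lemma three_le_multiplicity_obtain_line:
  assumes "3 \<le> point_multiplicity A q"
  obtains l where "l \<in> A" "q \<subseteq> l" "l \<noteq> l1" "l \<noteq> l2"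
proof -
  have "\<not> {l \<in> A. q \<subseteq> l} \<subseteq> {l1, l2}"
  proof
    assume "{l \<in> A. q \<subseteq> l} \<subseteq> {l1, l2}"
    then have "card {l \<in> A. q \<subseteq> l} \<le> card {l1, l2}"
      by (intro card_mono) auto
    also have "card {l1, l2} \<le> 2"
      by (simp add: card_insert_if)
    finally show False
      using assms by (simp add: point_multiplicity_def)
  qed
  with that show thesis by blast
qed

section \<open>Algebra of brackets\<close>

text \<open>
  The six unknowns stand for the brackets \<open>[12], [13], [14], [23], [24], [34]\<close>.
\<close>

lemma four_brackets_contradiction:
  fixes a b c d e f :: "'a::field_char_0"
  assumes nz: "a \<noteq> 0" "b \<noteq> 0" "c \<noteq> 0" "d \<noteq> 0" "e \<noteq> 0" "f \<noteq> 0"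
    and pluecker: "a * f - b * e + c * d = 0"
    and "b = d \<or> c = e" "a = - d \<or> c = f" "a = - e \<or> b = - f"
      "a = b \<or> e = f" "a = c \<or> d = - f" "b = c \<or> d = e"
  shows False
  \<comment> \<open>Six binary choices give 64 linear systems. Some force a bracket to equal its
    negative, hence to vanish; others are consistent, such as the one solved by
    \<open>b = c = d = - a = - e = - f\<close>, where the Pluecker relation reads
    \<open>3 * b^2 = 0\<close>.\<close>
  using assms(8-13) by (elim disjE) (use nz pluecker in simp_all)

text \<open>With three indices, \<open>k\<close> is forced for every pair. With four, each pair
  leaves two candidates, whence six disjunctions, which \<open>anti\<close> rewrites into the six
  brackets \<open>D i j\<close>, ..., \<open>D k l\<close>.\<close>

lemma no_bracket_configuration:
  fixes x y :: "'i \<Rightarrow> 'a::field_char_0"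
  defines "D i j \<equiv> x i * y j - y i * x j"
  assumes card: "card N = 3 \<or> card N = 4"
    and nz: "\<And>i j. i \<in> N \<Longrightarrow> j \<in> N \<Longrightarrow> i \<noteq> j \<Longrightarrow> D i j \<noteq> 0"
    and tri: "\<And>i j. i \<in> N \<Longrightarrow> j \<in> N \<Longrightarrow> i \<noteq> j \<Longrightarrow> \<exists>k\<in>N. k \<noteq> i \<and> k \<noteq> j \<and> D i k = D j k"
  shows False
proof -
  have anti: "D j i = - D i j" for i j
    by (simp add: D_def)
  from card show False
  proof
    assume "card N = 3"
    then obtain i j k where N: "N = {i, j, k}" "i \<noteq> j" "i \<noteq> k" "j \<noteq> k"
      by (auto simp: card_3_iff)
    have "D i k = D j k" "D i j = D k j" "D j i = D k i"
      using tri[of i j] tri[of i k] tri[of j k] N by auto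
    \<comment> \<open>The equations chain to
      \<open>D i k = D j k = - D i j = - D i k\<close>.\<close>
    then have "2 * D i k = 0"
      using anti[of i j] anti[of i k] anti[of j k] by simp
    with nz[of i k] N show False by simp
  next
    assume "card N = 4"
    then obtain i j k l where N: "N = {i, j, k, l}" and dist: "distinct [i, j, k, l]"
      by (auto simp: eval_nat_numeral card_Suc_eq)
    show False
    proof (rule four_brackets_contradiction)
      show "D i j * D k l - D i k * D j l + D i l * D j k = 0"
        by (simp add: D_def algebra_simps)
      show "D i j \<noteq> 0" "D i k \<noteq> 0" "D i l \<noteq> 0" "D j k \<noteq> 0" "D j l \<noteq> 0" "D k l \<noteq> 0"
        using nz N dist by auto
      show "D i k = D j k \<or> D i l = D j l"
        using tri[of i j] N dist by auto
      show "D i j = - D j k \<or> D i l = D k l"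
        using tri[of i k] N dist anti[of j k] by auto
      show "D i j = - D j l \<or> D i k = - D k l"
        using tri[of i l] N dist anti[of j l] anti[of k l] by auto
      show "D i j = D i k \<or> D j l = D k l"
        using tri[of j k] N dist anti[of i j] anti[of i k] by auto
      show "D i j = D i l \<or> D j k = - D k l"
        using tri[of j l] N dist anti[of i j] anti[of i l] anti[of k l] by auto
      show "D i k = D i l \<or> D j k = D j l"
        using tri[of k l] N dist anti[of i k] anti[of i l] anti[of j k] anti[of j l] by auto
    qed
  qed
qed

section \<open>From a modular point to brackets\<close>

text \<open>The bound 3 at the crossing points on \<open>L0\<close> supplies the lines
  \<open>L M\<close>; the value 3 or 4 at \<open>p\<close> is the size of the index set for the
  brackets.\<close>

lemma modular_point_multiplicity:
  fixes A :: "('a::field_char_0 ^ 3) set set"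
  assumes A: "finite A" "A \<subseteq> proj_lines"
    and p: "modular_point A p"
    and L0: "L0 \<in> A" "\<not> p \<subseteq> L0"
    and mult: "\<And>q. q \<in> crossing_points A \<Longrightarrow> 3 \<le> point_multiplicity A q"
    and mp: "point_multiplicity A p = 3 \<or> point_multiplicity A p = 4"
  shows False
proof -
  define N where "N = {M \<in> A. p \<subseteq> M}"
  define P where "P M = L0 \<inter> M" for M
  have pp: "p \<in> proj_points"
    using p by (simp add: modular_point_def crossing_points_def)
  have lines: "L \<in> proj_lines" if "L \<in> A" for L
    using that A by auto
  have NA: "M \<in> A" "p \<subseteq> M" "M \<noteq> L0" if "M \<in> N" for M
    using that L0 by (auto simp: N_def)
  have P: "P M \<in> proj_points" "P M \<subseteq> L0" "P M \<subseteq> M" "P M \<noteq> p" if "M \<in> N" for M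
    using proj_lines_Int[OF lines[OF L0(1)] lines[OF NA(1)[OF that]]] NA(3)[OF that] L0
    by (auto simp: P_def)
  have P_inj: "M = M'" if "M \<in> N" "M' \<in> N" "P M = P M'" for M M'
    using proj_line_eqI[OF pp P(1)[OF that(1)], of M M'] P(3,4) that NA lines by metis
  have "\<exists>L. L \<in> A \<and> P M \<subseteq> L \<and> L \<noteq> L0 \<and> L \<noteq> M" if "M \<in> N" for M
  proof -
    have "P M \<in> crossing_points A"
      using crossing_pointI[OF A(1) L0(1) NA(1)[OF that]] P[OF that] NA(3)[OF that] by metis
    then show ?thesis
      using mult three_le_multiplicity_obtain_line by metis
  qed
  then obtain L where L: "\<And>M. M \<in> N \<Longrightarrow> L M \<in> A" "\<And>M. M \<in> N \<Longrightarrow> P M \<subseteq> L M"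
    "\<And>M. M \<in> N \<Longrightarrow> L M \<noteq> L0" "\<And>M. M \<in> N \<Longrightarrow> L M \<noteq> M"
    by metis
  \<comment> \<open>Otherwise \<open>L M\<close> and \<open>M\<close> would share the distinct
    points \<open>p\<close> and \<open>P M\<close>.\<close>
  have p_L: "\<not> p \<subseteq> L M" if "M \<in> N" for M
    using proj_line_eqI[OF pp P(1)[OF that], of "L M" M] P[OF that] L[OF that] NA[OF that] lines
    by metis
  have P_L: "\<not> P M' \<subseteq> L M" if "M \<in> N" "M' \<in> N" "M \<noteq> M'" for M M'
    using proj_line_eqI[OF P(1)[OF that(1)] P(1)[OF that(2)], of "L M" L0] P P_inj L that L0 lines
    by metis

  obtain u where u: "u \<noteq> 0" "p = vec.span {u}"
    using proj_point_eq_span[OF pp] .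
  have sub: "vec.subspace l" if "l \<in> A" for l
    using lines[OF that] by (simp add: proj_lines_def)
  have "\<exists>v. v \<noteq> 0 \<and> P M = vec.span {v}" if "M \<in> N" for M
    using proj_point_eq_span[OF P(1)[OF that]] by metis
  then obtain w where w: "\<And>M. M \<in> N \<Longrightarrow> w M \<noteq> 0" "\<And>M. M \<in> N \<Longrightarrow> P M = vec.span {w M}"
    by metis
  \<comment> \<open>Since \<open>u\<close> is not in \<open>L0\<close>, the normalization presents
    \<open>L M\<close> as the graph of all \<open>z - g M z *s u\<close> with \<open>z\<close> in
    \<open>L0\<close>.\<close>
  have "\<exists>f. (\<forall>x y. f (x + y) = f x + f y) \<and> (\<forall>c x. f (c *s x) = c * f x) \<and> f u = 1
      \<and> (\<forall>x. f x = 0 \<longleftrightarrow> x \<in> L M)" if "M \<in> N" for M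
  proof -
    have "u \<notin> L M"
      using p_L[OF that] u(2) proj_point_subset_iff[OF sub[OF L(1)[OF that]]] by simp
    from proj_line_functional[OF lines[OF L(1)[OF that]] this] show ?thesis
      by metis
  qed
  then obtain g where g: "\<And>M x y. M \<in> N \<Longrightarrow> g M (x + y) = g M x + g M y"
    "\<And>M c x. M \<in> N \<Longrightarrow> g M (c *s x) = c * g M x" "\<And>M. M \<in> N \<Longrightarrow> g M u = 1"
    "\<And>M x. M \<in> N \<Longrightarrow> g M x = 0 \<longleftrightarrow> x \<in> L M"
    by metis
  have g_self: "g M (w M) = 0" if "M \<in> N" for M
    using g(4)[OF that] L(2)[OF that] w(2)[OF that] proj_point_subset_iff[OF sub[OF L(1)[OF that]]]
    by simp
  have g_other: "g M (w M') \<noteq> 0" if "M \<in> N" "M' \<in> N" "M \<noteq> M'" for M M'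
    using g(4)[OF that(1)] P_L[OF that] w(2)[OF that(2)]
      proj_point_subset_iff[OF sub[OF L(1)[OF that(1)]]]
    by simp
  \<comment> \<open>\<open>K\<close> joins \<open>p\<close> to the meeting point of
    \<open>L M\<close> and \<open>L M'\<close>. A vector spanning that point is
    \<open>\<alpha> *s u + \<beta> *s w K\<close> with \<open>\<beta> \<noteq> 0\<close>; as both
    forms vanish on it, they agree at \<open>w K\<close>.\<close>
  have tri: "\<exists>K\<in>N. K \<noteq> M \<and> K \<noteq> M' \<and> g M (w K) = g M' (w K)"
    if M: "M \<in> N" and M': "M' \<in> N" and "M \<noteq> M'" for M M'
  proof -
    define q where "q = L M \<inter> L M'"
    have LL: "L M \<noteq> L M'"
      using P_L[OF that] L(2)[OF M'] by metis
    have q: "q \<in> proj_points" "q \<subseteq> L M" "q \<subseteq> L M'"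
      using proj_lines_Int[OF lines[OF L(1)[OF M]] lines[OF L(1)[OF M']] LL] by (auto simp: q_def)
    have qp: "q \<noteq> p"
      using q p_L[OF M] by auto
    have "q \<in> crossing_points A"
      using crossing_pointI[OF A(1) L(1)[OF M] L(1)[OF M'] LL q] .
    define K where "K = line_through p q"
    have "K \<in> A"
      using p \<open>q \<in> crossing_points A\<close> qp by (simp add: K_def modular_point_def)
    have K: "p \<subseteq> K" "q \<subseteq> K"
      using vec.span_superset[of "p \<union> q"] by (auto simp: K_def line_through_def)
    with \<open>K \<in> A\<close> have KN: "K \<in> N"
      by (simp add: N_def)
    \<comment> \<open>If \<open>K = M1\<close>, then \<open>q\<close> and \<open>P M1\<close> are
      both the point where \<open>L M1\<close> meets \<open>M1\<close>, so \<open>P M1\<close> lies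
      on \<open>L M2\<close>, contrary to \<open>P_L\<close>.\<close>
    have ne: "K \<noteq> M1" if M1: "M1 \<in> N" "q \<subseteq> L M1" "M2 \<in> N" "M2 \<noteq> M1" "q \<subseteq> L M2" for M1 M2
    proof
      assume "K = M1"
      then have "q \<subseteq> L M1 \<inter> M1"
        using K M1 by auto
      moreover have "P M1 \<subseteq> L M1 \<inter> M1"
        using L(2) P(3) M1 by auto
      moreover have "L M1 \<inter> M1 \<in> proj_points"
        using proj_lines_Int lines L NA M1 by metis
      ultimately have "q = P M1"
        using proj_points_subset_imp_eq q(1) P(1) M1(1) by metis
      with P_L[OF M1(3,1,4)] M1(5) show False by simp
    qed
    obtain v where v: "v \<noteq> 0" "q = vec.span {v}"
      using proj_point_eq_span[OF q(1)] .
    have vK: "v \<in> K"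
      using K(2) v(2) proj_point_subset_iff[OF sub[OF \<open>K \<in> A\<close>]] by simp
    have "K = line_through p (P K)"
      using line_through_unique(2)[OF pp P(1)[OF KN]] P[OF KN] lines[OF \<open>K \<in> A\<close>] K(1) by metis
    then have "v \<in> vec.span {u, w K}"
      using vK line_through_span[of u "w K"] u(2) w(2)[OF KN] by metis
    then obtain \<alpha> \<beta> where ab: "v = \<alpha> *s u + \<beta> *s w K"
      by (rule span_pairE)
    have "\<beta> \<noteq> 0"
    proof
      assume "\<beta> = 0"
      then have "v \<in> p"
        using ab u(2) by (simp add: vec.span_base vec.span_scale)
      then have "q \<subseteq> p"
        using v(2) u(2) proj_point_subset_iff[of p v] by simp
      with qp proj_points_subset_imp_eq[OF q(1) pp] show False by simp
    qed
    moreover have "g M v = 0" "g M' v = 0"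
      using g(4)[OF M] g(4)[OF M'] q v(2) proj_point_subset_iff[OF sub[OF L(1)[OF M]]]
        proj_point_subset_iff[OF sub[OF L(1)[OF M']]]
      by auto
    then have "\<alpha> + \<beta> * g M (w K) = 0" "\<alpha> + \<beta> * g M' (w K) = 0"
      using g(1-3)[OF M] g(1-3)[OF M'] by (simp_all add: ab)
    then have "\<alpha> + \<beta> * g M (w K) = \<alpha> + \<beta> * g M' (w K)"
      by (simp only:)
    then have "\<beta> * g M (w K) = \<beta> * g M' (w K)"
      by (simp only: add_left_cancel)
    ultimately have "g M (w K) = g M' (w K)"
      by simp
    moreover have "K \<noteq> M" "K \<noteq> M'"
      using ne[OF M q(2) M' _ q(3)] ne[OF M' q(3) M _ q(2)] \<open>M \<noteq> M'\<close> by auto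
    ultimately show ?thesis
      using KN by blast
  qed

  have card: "card N = 3 \<or> card N = 4"
    using mp by (simp add: point_multiplicity_def N_def)
  then have "finite N" "\<not> card N \<le> Suc 0"
    by (auto intro: card_ge_0_finite)
  then obtain M1 M2 where M12: "M1 \<in> N" "M2 \<in> N" "M1 \<noteq> M2"
    by (auto simp: card_le_Suc0_iff_eq)
  have L0_eq: "L0 = vec.span {w M1, w M2}"
  proof -
    have "L0 = line_through (P M1) (P M2)"
      using line_through_unique(2)[OF P(1)[OF M12(1)] P(1)[OF M12(2)]] P P_inj M12 L0 lines by metis
    also have "\<dots> = vec.span {w M1, w M2}"
      using line_through_span[of "w M1" "w M2"] w(2) M12 by metis
    finally show ?thesis .
  qed
  have "\<exists>\<alpha> \<beta>. w M = \<alpha> *s w M1 + \<beta> *s w M2" if "M \<in> N" for M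
  proof -
    have "w M \<in> vec.span {w M1, w M2}"
      using P(2)[OF that] w(2)[OF that] proj_point_subset_iff[OF sub[OF L0(1)]] L0_eq by simp
    then show ?thesis
      by (meson span_pairE)
  qed
  then obtain \<alpha> \<beta> where ab: "\<And>M. M \<in> N \<Longrightarrow> w M = \<alpha> M *s w M1 + \<beta> M *s w M2"
    by metis
  \<comment> \<open>\<open>(x M, y M)\<close> are the coefficients of \<open>g M\<close> restricted
    to \<open>L0\<close>, in the basis \<open>w M1\<close>, \<open>w M2\<close>.\<close>
  define x where "x M = g M (w M1)" for M
  define y where "y M = g M (w M2)" for M
  have gw: "g M (w K) = \<alpha> K * x M + \<beta> K * y M" if "M \<in> N" "K \<in> N" for M K
    using ab[OF that(2)] g(1,2)[OF that(1)] by (simp add: x_def y_def)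
  \<comment> \<open>\<open>(x K, y K)\<close> and \<open>(\<beta> K, - \<alpha> K)\<close> are nonzero and both orthogonal to \<open>(\<alpha> K, \<beta> K)\<close>.\<close>
  have "\<exists>r. r \<noteq> 0 \<and> x K = r * \<beta> K \<and> y K = - r * \<alpha> K" if "K \<in> N" for K
  proof -
    obtain M where M: "M \<in> N" "M \<noteq> K"
      using M12 by metis
    have 0: "\<alpha> K * x K + \<beta> K * y K = 0"
      using gw[OF that that] g_self[OF that] by simp
    have 1: "\<alpha> K * x M + \<beta> K * y M \<noteq> 0" "\<alpha> M * x K + \<beta> M * y K \<noteq> 0"
      using gw g_other that M by metis+
    show ?thesis
    proof (cases "\<beta> K = 0")
      case True
      with 0 1 show ?thesis
        by (intro exI[of _ "- y K / \<alpha> K"]) auto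
    next
      case False
      with 0 1 show ?thesis
        by (intro exI[of _ "x K / \<beta> K"]) (auto simp: field_simps add_eq_0_iff)
    qed
  qed
  then obtain r where r: "\<And>K. K \<in> N \<Longrightarrow> r K \<noteq> 0" "\<And>K. K \<in> N \<Longrightarrow> x K = r K * \<beta> K"
    "\<And>K. K \<in> N \<Longrightarrow> y K = - r K * \<alpha> K"
    by metis
  \<comment> \<open>The bracket of \<open>M\<close> and \<open>K\<close> is \<open>g M (w K)\<close>
    up to a nonzero factor depending on \<open>K\<close> alone, so equal values at
    \<open>w K\<close> in \<open>tri\<close> become equal brackets.\<close>
  have D: "x M * y K - y M * x K = - r K * g M (w K)" if "M \<in> N" "K \<in> N" for M K
    using gw[OF that] r(2,3)[OF that(2)] by (simp add: algebra_simps)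
  show False
  proof (rule no_bracket_configuration[OF card, of x y])
    fix M M'
    assume M: "M \<in> N" "M' \<in> N" "M \<noteq> M'"
    then show "x M * y M' - y M * x M' \<noteq> 0"
      using g_other r(1) by (simp add: D)
    show "\<exists>K\<in>N. K \<noteq> M \<and> K \<noteq> M' \<and> x M * y K - y M * x K = x M' * y K - y M' * x K"
      using tri[OF M] M D by (metis (no_types))
  qed
qed

theorem theorem17:
  fixes A :: "(complex ^ 3) set set"
  assumes "line_arrangement A"
    and "\<not> pencil A" and "\<not> near_pencil A"
    and "\<forall>p \<in> crossing_points A. point_multiplicity A p = 3 \<or> point_multiplicity A p = 4"
  shows "\<not> supersolvable A"
proof
  assume "supersolvable A"
  then obtain p where p: "modular_point A p"
    by (auto simp: supersolvable_def)
  then have pc: "p \<in> crossing_points A"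
    by (simp add: modular_point_def)
  \<comment> \<open>\<open>A\<close> is not a pencil, so some line misses \<open>p\<close>.\<close>
  then obtain L0 where "L0 \<in> A" "\<not> p \<subseteq> L0"
    using assms(2) unfolding pencil_def crossing_points_def by blast
  with assms(1,4) p pc show False
    by (intro modular_point_multiplicity[of A p L0]) (auto simp: line_arrangement_def)
qed

end
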